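(* Let $p$ be a prime, let $G$ be a finite $p$-group, and let $k\ge 1$ be an integer with $p^k\le |G|$. Then $G\in\mathcal{M}(p^k)$ if and only if $\Phi(G)$ is contained in every subgroup of $G$ of order $p^{k-1}$.
   Context: All groups are finite. $\Phi(X)$ denotes the Frattini subgroup of $X$. $A<B$ means that $A$ is a proper subgroup of $B$. A subgroup $H$ of $G$ is $\mathcal{M}$-supplemented in $G$ if there exists a subgroup $K$ of $G$ such that $G=HK$ and $H_iK<G$ (that is, $H_iK$ is a proper subgroup of $G$) for every maximal subgroup $H_i$ of $H$. For a prime power $p^k$ with $p\le p^k\le |G|_p$, where $|G|_p$ is the order of a Sylow $p$-subgroup of $G$, we write $G\in\mathcal{M}(p^k)$ if all subgroups of $G$ of order $p^k$ are $\mathcal{M}$-supplemented in $G$. *)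

theory Defs
  imports "HOL-Algebra.Sylow"
begin

definition finite_p_group :: "nat \<Rightarrow> ('a, 'b) monoid_scheme \<Rightarrow> bool" where
  "finite_p_group p G \<longleftrightarrow> group G \<and> finite (carrier G) \<and> (\<exists>n. order G = p ^ n)"

definition proper_subgroup :: "'a set \<Rightarrow> ('a, 'b) monoid_scheme \<Rightarrow> bool" where
  "proper_subgroup H G \<longleftrightarrow> subgroup H G \<and> H \<noteq> carrier G"

definition maximal_subgroup :: "'a set \<Rightarrow> ('a, 'b) monoid_scheme \<Rightarrow> bool" where
  "maximal_subgroup M G \<longleftrightarrow>
     proper_subgroup M G \<and> \<not> (\<exists>L. proper_subgroup L G \<and> M \<subset> L)"

text \<open>Intersecting with the carrier makes the Frattini subgroup of a group without
  maximal subgroups (the trivial group, in the finite case) the whole group.\<close>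

definition frattini :: "('a, 'b) monoid_scheme \<Rightarrow> 'a set" where
  "frattini G = carrier G \<inter> \<Inter> {M. maximal_subgroup M G}"

text \<open>A product of two subgroups need not be a subgroup: that the products
  \<open>H\<^sub>i K\<close> are subgroups is part of the condition.\<close>

definition M_supplemented :: "'a set \<Rightarrow> ('a, 'b) monoid_scheme \<Rightarrow> bool" where
  "M_supplemented H G \<longleftrightarrow>
     (\<exists>K. subgroup K G \<and> carrier G = H <#>\<^bsub>G\<^esub> K \<and>
        (\<forall>H\<^sub>i. maximal_subgroup H\<^sub>i (G\<lparr>carrier := H\<rparr>) \<longrightarrow> proper_subgroup (H\<^sub>i <#>\<^bsub>G\<^esub> K) G))"

text \<open>The class \<open>\<M>(q)\<close>, to be used for prime powers \<open>q = p ^ k\<close> with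
  \<open>p \<le> q\<close> and \<open>q\<close> at most the order of a Sylow \<open>p\<close>-subgroup.\<close>

definition in_class_M :: "('a, 'b) monoid_scheme \<Rightarrow> nat \<Rightarrow> bool" where
  "in_class_M G q \<longleftrightarrow> (\<forall>H. subgroup H G \<and> card H = q \<longrightarrow> M_supplemented H G)"

end

theory Submission
  imports Defs "HOL-Algebra.Zassenhaus"
begin

text \<open>Write \<open>\<Phi>\<close> for the Frattini subgroup of \<open>G\<close>. Everything rests on the fact that a maximal
  subgroup of a finite \<open>p\<close>-group is normal (\<open>maximal_subgroup_normal\<close>) and has index \<open>p\<close>
  (\<open>order_maximal_subgroup\<close>). Hence the maximal subgroups of a subgroup \<open>H\<close> of order \<open>p ^ k\<close> have
  order \<open>p ^ (k - 1)\<close>, and a subgroup of order \<open>p ^ (k - 1)\<close> that is properly contained in a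
  subgroup \<open>J\<close> is maximal in some subgroup \<open>H\<close> of \<open>J\<close> of order \<open>p ^ k\<close>.

  Suppose that every subgroup of order \<open>p ^ (k - 1)\<close> contains \<open>\<Phi>\<close>, and let \<open>H\<close> have order \<open>p ^ k\<close>.
  Among the normal subgroups \<open>K\<close> with \<open>H K = G\<close> choose a minimal one. If \<open>H \<inter> K\<close> were not contained
  in a maximal subgroup \<open>M\<close>, then \<open>M \<inter> K\<close> would be a smaller normal supplement; so \<open>H \<inter> K \<le> \<Phi>\<close>.
  Every maximal subgroup \<open>L\<close> of \<open>H\<close> therefore contains \<open>H \<inter> K\<close>, and \<open>L K = G\<close> would give
  \<open>H = L (H \<inter> K) = L\<close> by Dedekind's law (\<open>M_supplemented_if_frattini_le_maximal\<close>).

  Conversely, suppose that \<open>L\<close> has order \<open>p ^ (k - 1)\<close> and does not contain \<open>\<Phi>\<close>. Then there is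
  \<open>H \<le> \<Phi> L\<close> of order \<open>p ^ k\<close> in which \<open>L\<close> is maximal. For a supplement \<open>K\<close> as in the definition,
  \<open>L K\<close> lies in a maximal subgroup \<open>M\<close> of \<open>G\<close>. But \<open>M\<close> contains \<open>\<Phi>\<close> as well, hence \<open>H\<close>, hence
  \<open>H K = G\<close>, a contradiction (\<open>not_M_supplemented_if_le_frattini_mult\<close>).

  Normality of maximal subgroups comes from letting a proper subgroup \<open>L\<close> act on its own cosets:
  their number is divisible by \<open>p\<close>, so the coset \<open>L\<close> is not the only fixed point, and a second
  fixed point yields an element of the normalizer outside \<open>L\<close>. The index of a maximal subgroup
  \<open>M\<close> is then \<open>p\<close> because \<open>G\<close> modulo \<open>M\<close> has a subgroup of order \<open>p\<close> by Sylow's theorem.\<close>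

section \<open>Fixed points of a group of prime power order\<close>

text \<open>An action is a homomorphism into a group of extensional bijections; the usual axioms
  suffice, since the inverse of a group element acts as the inverse map.\<close>

lemma (in group) group_actionI:
  assumes closed: "\<And>g x. g \<in> carrier G \<Longrightarrow> x \<in> E \<Longrightarrow> f g x \<in> E"
    and one: "\<And>x. x \<in> E \<Longrightarrow> f \<one> x = x"
    and mult: "\<And>g h x. g \<in> carrier G \<Longrightarrow> h \<in> carrier G \<Longrightarrow> x \<in> E \<Longrightarrow> f (g \<otimes> h) x = f g (f h x)"
  shows "group_action G E (\<lambda>g. restrict (f g) E)"
proof -
  have inv: "f (inv g) (f g x) = x" "f g (f (inv g) x) = x" if "g \<in> carrier G" "x \<in> E" for g x
    using that mult[of "inv g" g x] mult[of g "inv g" x] one by simp_all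
  have Bij: "restrict (f g) E \<in> Bij E" if g: "g \<in> carrier G" for g
  proof -
    have "bij_betw (f g) E E"
      by (rule bij_betwI[where g = "f (inv g)"]) (use g closed inv in auto)
    then show ?thesis
      by (simp add: Bij_def bij_betw_restrict_eq)
  qed
  have hom: "restrict (f (g \<otimes> h)) E = compose E (restrict (f g) E) (restrict (f h) E)"
    if "g \<in> carrier G" "h \<in> carrier G" for g h
    using that closed mult by (auto simp: compose_def restrict_def)
  have "(\<lambda>g. restrict (f g) E) \<in> hom G (BijGroup E)"
    by (rule homI) (simp_all add: BijGroup_def Bij hom)
  then show ?thesis
    by (simp add: group_action_def group_hom_def group_hom_axioms_def group_BijGroup is_group)
qed

text \<open>The inverse turns right multiplication, which reverses products, into a left action.\<close>

lemma (in group) action_on_rcosets: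
  assumes "subgroup L G"
  shows "group_action G (rcosets L) (\<lambda>g. \<lambda>C \<in> rcosets L. C #> inv g)"
proof (rule group_actionI)
  note L = subgroup.subset[OF assms]
  show "C #> inv g \<in> rcosets L" if "g \<in> carrier G" "C \<in> rcosets L" for g C
    using that L by (auto simp: RCOSETS_def coset_mult_assoc)
  show "C #> inv \<one> = C" if "C \<in> rcosets L" for C
    using that L by (auto simp: RCOSETS_def coset_mult_assoc)
  show "C #> inv (g \<otimes> h) = (C #> inv h) #> inv g"
    if "g \<in> carrier G" "h \<in> carrier G" "C \<in> rcosets L" for g h C
    using that L by (auto simp: RCOSETS_def coset_mult_assoc inv_mult_group m_assoc)
qed

text \<open>Orbit lengths divide \<open>p ^ n\<close>, so the orbits with more than one point contribute a multiple
  of \<open>p\<close> to the cardinality of the set. As \<open>p\<close> divides this cardinality, the number of fixed points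
  is a multiple of \<open>p\<close> too, and it cannot be \<open>1\<close>.\<close>

lemma (in group_action) another_fixed_point:
  assumes p: "prime p" and order: "order G = p ^ n"
    and E: "finite E" "p dvd card E"
    and x0: "x0 \<in> E" "\<And>g. g \<in> carrier G \<Longrightarrow> \<phi> g x0 = x0"
  shows "\<exists>x \<in> E. x \<noteq> x0 \<and> (\<forall>g \<in> carrier G. \<phi> g x = x)"
proof (rule ccontr)
  assume "\<not> ?thesis"
  then have nofix: "\<exists>g \<in> carrier G. \<phi> g x \<noteq> x" if "x \<in> E" "x \<noteq> x0" for x
    using that by blast
  interpret group G using group_hom group_hom.axioms(1) by blast
  have orb0: "orbit G \<phi> x0 = {x0}"
    using x0(2) by (auto simp: orbit_def intro: exI[of _ "\<one>"])
  have "p dvd card orb" if "orb \<in> orbits G E \<phi> - {{x0}}" for orb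
  proof -
    from that obtain x where x: "x \<in> E" and orb: "orb = orbit G \<phi> x" and "orb \<noteq> {x0}"
      by (auto simp: orbits_def)
    then have "x \<noteq> x0" using orb0 by auto
    then obtain g where g: "g \<in> carrier G" "\<phi> g x \<noteq> x"
      using nofix x by blast
    have "card orb dvd p ^ n"
      using orbit_stabilizer_theorem[OF x] orb order by (metis dvd_triv_left)
    then obtain i where i: "card orb = p ^ i"
      using divides_primepow_nat[OF p] by blast
    have "card orb \<noteq> 1"
    proof
      assume "card orb = 1"
      then obtain y where y: "orb = {y}"
        by (auto simp: card_1_singleton_iff)
      have "\<phi> g x \<in> orb" "x \<in> orb"
        using g(1) orbit_refl[OF x] by (auto simp: orb orbit_def)
      with y g(2) show False by simp
    qed
    with i show ?thesis by (cases i) auto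
  qed
  then have "p dvd (\<Sum>orb \<in> orbits G E \<phi> - {{x0}}. card orb)"
    by (rule dvd_sum)
  moreover have "card E = 1 + (\<Sum>orb \<in> orbits G E \<phi> - {{x0}}. card orb)"
  proof -
    have "card E = (\<Sum>orb \<in> orbits G E \<phi>. card orb)"
      using disjoint_sum[OF E(1), of "\<lambda>_. 1 :: nat"] by simp
    also have "\<dots> = 1 + (\<Sum>orb \<in> orbits G E \<phi> - {{x0}}. card orb)"
    proof (subst sum.remove)
      show "finite (orbits G E \<phi>)" using E(1) by (simp add: orbits_def)
      show "{x0} \<in> orbits G E \<phi>" using x0(1) orb0 by (auto simp: orbits_def)
    qed simp
    finally show ?thesis .
  qed
  ultimately have "p dvd 1"
    using E(2) by (metis dvd_add_left_iff)
  with p show False by simp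
qed

section \<open>Maximal subgroups of finite groups\<close>

lemma maximal_subgroupD:
  assumes "maximal_subgroup M G"
  shows "subgroup M G" and "M \<noteq> carrier G"
    and "subgroup L G \<Longrightarrow> M \<subseteq> L \<Longrightarrow> L = M \<or> L = carrier G"
  using assms by (auto simp: maximal_subgroup_def proper_subgroup_def)

lemma (in group) finite_subgroups:
  assumes "finite (carrier G)"
  shows "finite {H. subgroup H G}"
  by (rule finite_subset[of _ "Pow (carrier G)"]) (use assms subgroup.subset in auto)

lemma (in group) proper_subgroup_le_maximal:
  assumes "finite (carrier G)" "proper_subgroup L G"
  obtains M where "maximal_subgroup M G" "L \<subseteq> M"
proof -
  let ?S = "{M. proper_subgroup M G \<and> L \<subseteq> M}"
  have "finite ?S"
    by (rule finite_subset[OF _ finite_subgroups[OF assms(1)]]) (auto simp: proper_subgroup_def)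
  moreover have "L \<in> ?S" using assms(2) by simp
  ultimately have "\<exists>M \<in> ?S. L \<subseteq> M \<and> (\<forall>N \<in> ?S. M \<subseteq> N \<longrightarrow> M = N)"
    by (rule finite_has_maximal2)
  then obtain M where "M \<in> ?S" "\<forall>N \<in> ?S. M \<subseteq> N \<longrightarrow> M = N"
    by (elim bexE conjE)
  then have "maximal_subgroup M G" "L \<subseteq> M"
    by (auto simp: maximal_subgroup_def)
  then show ?thesis by (rule that)
qed

text \<open>A minimal one among the subgroups of \<open>J\<close> properly containing \<open>L\<close> will do. In a \<open>p\<close>-group this
  produces subgroups whose order is exactly \<open>p\<close> times that of \<open>L\<close>.\<close>

lemma (in group) subgroup_above_with_maximal:
  assumes fin: "finite (carrier G)" and L: "subgroup L G" and J: "subgroup J G" and "L \<subset> J"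
  obtains H where "subgroup H G" "H \<subseteq> J" "maximal_subgroup L (G\<lparr>carrier := H\<rparr>)"
proof -
  let ?S = "{H. subgroup H G \<and> L \<subset> H \<and> H \<subseteq> J}"
  have "finite ?S"
    by (rule finite_subset[OF _ finite_subgroups[OF fin]]) auto
  moreover have "J \<in> ?S" using assms by simp
  ultimately have "\<exists>H \<in> ?S. H \<subseteq> J \<and> (\<forall>N \<in> ?S. N \<subseteq> H \<longrightarrow> H = N)"
    by (rule finite_has_minimal2)
  then obtain H where H: "H \<in> ?S" and min: "\<forall>N \<in> ?S. N \<subseteq> H \<longrightarrow> H = N"
    by (elim bexE conjE)
  have "proper_subgroup L (G\<lparr>carrier := H\<rparr>)"
    using H L subgroup_incl[of L H] by (auto simp: proper_subgroup_def)
  moreover have False if "proper_subgroup N (G\<lparr>carrier := H\<rparr>)" "L \<subset> N" for N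
  proof -
    have N: "subgroup N (G\<lparr>carrier := H\<rparr>)" "N \<noteq> H"
      using that(1) by (auto simp: proper_subgroup_def)
    then have "subgroup N G" "N \<subseteq> H"
      using H incl_subgroup subgroup.subset by force+
    with H that(2) have "N \<in> ?S" by auto
    with min N(2) \<open>N \<subseteq> H\<close> show False by auto
  qed
  ultimately have "maximal_subgroup L (G\<lparr>carrier := H\<rparr>)"
    by (auto simp: maximal_subgroup_def)
  with H show ?thesis by (auto intro: that)
qed

lemma (in group) subset_set_mult:
  assumes "subgroup A G" "subgroup B G"
  shows "A \<subseteq> A <#> B" and "B \<subseteq> A <#> B"
proof -
  have "\<one> \<in> A" "\<one> \<in> B" using assms by (simp_all add: subgroup.one_closed)
  moreover have "A \<subseteq> carrier G" "B \<subseteq> carrier G" using assms by (simp_all add: subgroup.subset)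
  ultimately show "A \<subseteq> A <#> B" "B \<subseteq> A <#> B"
    unfolding set_mult_def by (force intro: r_one[symmetric], force intro: l_one[symmetric])
qed

section \<open>Maximal subgroups of finite p-groups\<close>

locale finite_prime_power_group = group G for G (structure) +
  fixes p :: nat
  assumes prime: "prime p" and finite_carrier: "finite (carrier G)"
    and prime_power_order: "\<exists>n. order G = p ^ n"
begin

lemma card_subgroup_prime_power:
  assumes "subgroup H G"
  shows "\<exists>i. card H = p ^ i"
proof -
  have "card H dvd order G" using lagrange[OF assms] by (metis dvd_triv_right)
  then show ?thesis
    using prime_power_order divides_primepow_nat[OF prime] by metis
qed

lemma subgroup_finite_prime_power_group:
  assumes "subgroup H G"
  shows "finite_prime_power_group (G\<lparr>carrier := H\<rparr>) p"
proof (intro finite_prime_power_group.intro finite_prime_power_group_axioms.intro)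
  show "group (G\<lparr>carrier := H\<rparr>)" by (rule subgroup_imp_group[OF assms])
  show "prime p" by (rule prime)
  show "finite (carrier (G\<lparr>carrier := H\<rparr>))"
    using subgroup.subset[OF assms] finite_carrier by (simp add: finite_subset)
  show "\<exists>n. order (G\<lparr>carrier := H\<rparr>) = p ^ n"
    using card_subgroup_prime_power[OF assms] by (simp add: order_def)
qed

lemma dvd_index:
  assumes L: "subgroup L G" and "L \<noteq> carrier G"
  shows "p dvd card (rcosets L)"
proof -
  have "card (rcosets L) * card L = order G" by (rule lagrange[OF L])
  then have "card (rcosets L) dvd order G" by (metis dvd_triv_left)
  then obtain i where i: "card (rcosets L) = p ^ i"
    using prime_power_order divides_primepow_nat[OF prime] by metis
  have "i \<noteq> 0"
  proof
    assume "i = 0"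
    then have "card L = card (carrier G)"
      using i lagrange[OF L] by (simp add: order_def)
    with subgroup.subset[OF L] assms(2) finite_carrier show False
      by (simp add: card_subset_eq)
  qed
  with i show ?thesis by simp
qed

text \<open>A coset \<open>L x\<close> is fixed by right multiplication with \<open>L\<close> precisely when \<open>x\<close> conjugates \<open>L\<close>
  into itself. So the second fixed point of \<open>L\<close> on its cosets, which exists because \<open>p\<close> divides
  the index, is represented by an element of the normalizer outside \<open>L\<close>.\<close>

lemma normalizer_grows:
  assumes L: "subgroup L G" and ne: "L \<noteq> carrier G"
  shows "L \<subset> normalizer G L"
proof -
  note LG = subgroup.subset[OF L]
  have finL: "finite L" using LG finite_carrier by (rule finite_subset)
  let ?\<phi> = "\<lambda>g. \<lambda>C \<in> rcosets L. C #> inv g"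
  interpret G: group_action G "rcosets L" ?\<phi> by (rule action_on_rcosets[OF L])
  interpret L: group_action "G\<lparr>carrier := L\<rparr>" "rcosets L" ?\<phi> by (rule G.induced_action[OF L])
  have fin: "finite (rcosets L)"
    using finite_carrier by (simp add: RCOSETS_def)
  have L_in: "L \<in> rcosets L" using L by (rule subgroup.subgroup_in_rcosets) (rule is_group)
  have "\<exists>C \<in> rcosets L. C \<noteq> L \<and> (\<forall>l \<in> carrier (G\<lparr>carrier := L\<rparr>). ?\<phi> l C = C)"
  proof (rule L.another_fixed_point[OF prime _ fin dvd_index[OF L ne] L_in])
    show "order (G\<lparr>carrier := L\<rparr>) = p ^ (SOME i. card L = p ^ i)"
      using someI_ex[OF card_subgroup_prime_power[OF L]] by (simp add: order_def)
    show "?\<phi> l L = L" if "l \<in> carrier (G\<lparr>carrier := L\<rparr>)" for l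
      using that L_in L LG by (simp add: coset_join2 subgroup.m_inv_closed subsetD)
  qed
  then obtain C where C: "C \<in> rcosets L" "C \<noteq> L" "\<And>l. l \<in> L \<Longrightarrow> ?\<phi> l C = C"
    by auto
  then obtain x where x: "x \<in> carrier G" "C = L #> x"
    unfolding RCOSETS_def by blast
  \<comment> \<open>The action involves the inverse, so apply it to the inverse of \<open>l\<close>.\<close>
  have L_fix: "L #> x #> l = L #> x" if l: "l \<in> L" for l
    using C(3)[of "inv l"] C(1) l L LG x(2) by (simp add: subgroup.m_inv_closed subsetD)
  have conj: "x \<otimes> l \<otimes> inv x \<in> L" if l: "l \<in> L" for l
  proof -
    have lG: "l \<in> carrier G" using l LG by blast
    have "L #> (x \<otimes> l) = L #> x"
      using L_fix[OF l] x(1) lG LG by (simp add: coset_mult_assoc)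
    then have "L #> (x \<otimes> l \<otimes> inv x) = L"
      using coset_mult_inv2[of L "x \<otimes> l" x] x(1) lG LG by simp
    then show ?thesis
      using coset_join1 x(1) lG L by simp
  qed
  \<comment> \<open>Conjugation is injective and \<open>L\<close> is finite, so the inclusion is an equality.\<close>
  have "x <# L #> inv x = L"
  proof (rule card_subset_eq[OF finL])
    show "x <# L #> inv x \<subseteq> L" using conj by (auto simp: l_coset_def r_coset_def)
    have "x <# L #> inv x = (\<lambda>l. x \<otimes> l \<otimes> inv x) ` L" by (auto simp: l_coset_def r_coset_def)
    moreover have "inj_on (\<lambda>l. x \<otimes> l \<otimes> inv x) L"
      using x(1) LG by (auto intro!: inj_onI dest: conjugation_is_inj)
    ultimately show "card (x <# L #> inv x) = card L" by (simp add: card_image)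
  qed
  then have "x \<in> normalizer G L"
    using x(1) LG by (simp add: normalizer_def stabilizer_def)
  moreover have "x \<notin> L" using x C(2) coset_join2[OF _ L] by blast
  moreover have "L \<subseteq> normalizer G L"
    using subgroup.subset[OF normal_imp_subgroup[OF subgroup_in_normalizer[OF L]]] by simp
  ultimately show ?thesis by blast
qed

lemma maximal_subgroup_normal:
  assumes "maximal_subgroup M G"
  shows "M \<lhd> G"
proof -
  note M = maximal_subgroupD[OF assms]
  have "normalizer G M = carrier G"
    using M(3)[OF normalizer_imp_subgroup[OF subgroup.subset[OF M(1)]]] normalizer_grows[OF M(1,2)]
    by blast
  with subgroup_in_normalizer[OF M(1)] show ?thesis by simp
qed

text \<open>The preimage of a subgroup of order \<open>p\<close> of the quotient by \<open>M\<close> has order \<open>p\<close> times that of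
  \<open>M\<close>, and by maximality it is the whole group.\<close>

lemma order_maximal_subgroup:
  assumes "maximal_subgroup M G"
  shows "order G = p * card M"
proof -
  note M = maximal_subgroupD[OF assms]
  interpret normal M G by (rule maximal_subgroup_normal[OF assms])
  have oQ: "order (G Mod M) = card (rcosets M)" by (simp add: order_def FactGroup_def)
  obtain m where m: "card (rcosets M) = p * m" using dvd_index[OF M(1,2)] by auto
  have "finite (carrier (G Mod M))"
    using finite_carrier by (simp add: FactGroup_def RCOSETS_def)
  then obtain Q where Q: "subgroup Q (G Mod M)" "card Q = p"
    using sylow_thm[OF prime factorgroup_is_group, of 1 m] oQ m by auto
  have U: "subgroup (\<Union>Q) G" by (rule factgroup_subgroup_union_subgroup[OF Q(1)])
  have "M \<in> Q" using subgroup.one_closed[OF Q(1)] by (simp add: FactGroup_def)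
  then have MU: "M \<subseteq> \<Union>Q" by blast
  have "subgroup M (G\<lparr>carrier := \<Union>Q\<rparr>)" by (rule subgroup_incl[OF M(1) U MU])
  from group.lagrange[OF subgroup_imp_group[OF U] this] have "card Q * card M = card (\<Union>Q)"
    by (simp add: order_def flip: factgroup_subgroup_union_factor[OF Q(1)])
  then have card: "card (\<Union>Q) = p * card M" using Q(2) by simp
  have "card M > 0" using M(1) finite_carrier subgroup.finite_imp_card_positive by blast
  then have "\<Union>Q \<noteq> M" using card prime_gt_1_nat[OF prime] by auto
  with M(3)[OF U MU] card show ?thesis by (simp add: order_def)
qed

lemma maximal_subgroup_of_subgroup_card:
  assumes "subgroup H G" "maximal_subgroup L (G\<lparr>carrier := H\<rparr>)"
  shows "card H = p * card L"
  using finite_prime_power_group.order_maximal_subgroup[OF subgroup_finite_prime_power_group[OF assms(1)] assms(2)]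
  by (simp add: order_def)

lemma normal_frattini: "frattini G \<lhd> G"
proof -
  have sub: "subgroup (\<Inter> (insert (carrier G) {M. maximal_subgroup M G})) G"
    by (rule subgroups_Inter) (auto simp: subgroup_self maximal_subgroupD(1))
  have "frattini G = \<Inter> (insert (carrier G) {M. maximal_subgroup M G})"
    by (simp add: frattini_def)
  then have "subgroup (frattini G) G"
    using sub by simp
  moreover have "x \<otimes> h \<otimes> inv x \<in> frattini G" if "x \<in> carrier G" "h \<in> frattini G" for x h
    using that maximal_subgroup_normal normal_inv_iff by (auto simp: frattini_def)
  ultimately show ?thesis by (simp add: normal_inv_iff)
qed

section \<open>Supplements\<close>

text \<open>The supplement is a minimal normal one, which always exists as \<open>G\<close> itself is one. Its
  normality makes the products \<open>L K\<close> subgroups; its minimality forces the intersection with \<open>H\<close>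
  into every maximal subgroup of \<open>G\<close>.\<close>

lemma M_supplemented_if_frattini_le_maximal:
  assumes H: "subgroup H G"
    and le: "\<And>L. maximal_subgroup L (G\<lparr>carrier := H\<rparr>) \<Longrightarrow> frattini G \<subseteq> L"
  shows "M_supplemented H G"
proof -
  note HG = subgroup.subset[OF H]
  let ?S = "{K. K \<lhd> G \<and> H <#> K = carrier G}"
  have "finite ?S"
    by (rule finite_subset[OF _ finite_subgroups[OF finite_carrier]]) (auto simp: normal_imp_subgroup)
  moreover have "carrier G \<in> ?S"
  proof -
    have "carrier G \<lhd> G" by (simp add: normal_inv_iff subgroup_self)
    then show ?thesis
      using set_mult_carrier_idem[OF H] commut_normal[OF H] by simp
  qed
  ultimately have "\<exists>K \<in> ?S. K \<subseteq> carrier G \<and> (\<forall>N \<in> ?S. N \<subseteq> K \<longrightarrow> K = N)"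
    by (rule finite_has_minimal2)
  then obtain K where "K \<in> ?S" and min: "\<forall>N \<in> ?S. N \<subseteq> K \<longrightarrow> K = N"
    by (elim bexE conjE)
  then have K: "K \<lhd> G" and HK: "H <#> K = carrier G" by simp_all
  note KG = subgroup.subset[OF normal_imp_subgroup[OF K]]
  have "H \<inter> K \<subseteq> M" if M: "maximal_subgroup M G" for M
  proof (rule ccontr)
    assume "\<not> H \<inter> K \<subseteq> M"
    then obtain d where d: "d \<in> H" "d \<in> K" "d \<notin> M" by blast
    note MD = maximal_subgroupD[OF M]
    have MG: "M \<lhd> G" by (rule maximal_subgroup_normal[OF M])
    have DG: "subgroup (H \<inter> K) G"
      by (rule subgroups_Inter_pair[OF H normal_imp_subgroup[OF K]])
    have "subgroup (M <#> (H \<inter> K)) G" by (rule mult_norm_subgroup[OF MG DG])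
    moreover have "M \<subseteq> M <#> (H \<inter> K)" "d \<in> M <#> (H \<inter> K)"
      using subset_set_mult[OF MD(1) DG] d by auto
    ultimately have "M <#> (H \<inter> K) = carrier G"
      using MD(3) d(3) by blast
    then have DM: "(H \<inter> K) <#> M = carrier G"
      using commut_normal[OF DG MG] by simp
    \<comment> \<open>From \<open>G = (H \<inter> K) M\<close> follows \<open>K = (H \<inter> K) (M \<inter> K)\<close>, so \<open>M \<inter> K\<close> still supplements \<open>H\<close>.\<close>
    have "H <#> (M \<inter> K) = carrier G"
    proof
      show "H <#> (M \<inter> K) \<subseteq> carrier G"
        using HG KG by (intro setmult_subset_G) auto
      show "carrier G \<subseteq> H <#> (M \<inter> K)"
      proof
        fix g assume "g \<in> carrier G"
        then have "g \<in> H <#> K" using HK by simp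
        then obtain h k where hk: "h \<in> H" "k \<in> K" "g = h \<otimes> k"
          by (auto simp: set_mult_def)
        then have "k \<in> (H \<inter> K) <#> M" using KG DM by auto
        then obtain e m where em: "e \<in> H" "e \<in> K" "m \<in> M" "k = e \<otimes> m"
          by (auto simp: set_mult_def)
        have inG: "h \<in> carrier G" "k \<in> carrier G" "e \<in> carrier G" "m \<in> carrier G"
          using hk em HG KG subgroup.subset[OF MD(1)] by auto
        have "m = inv e \<otimes> k" using em(4) inG by (simp add: inv_solve_left)
        then have "m \<in> K"
          using em(2) hk(2) normal_imp_subgroup[OF K]
          by (simp add: subgroup.m_closed subgroup.m_inv_closed)
        moreover have "g = (h \<otimes> e) \<otimes> m" using hk(3) em(4) inG by (simp add: m_assoc)
        moreover have "h \<otimes> e \<in> H" using hk(1) em(1) H by (simp add: subgroup.m_closed)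
        ultimately show "g \<in> H <#> (M \<inter> K)" using em(3) by (auto simp: set_mult_def)
      qed
    qed
    then have "M \<inter> K = K"
      using min normal_subgroup_intersect[OF MG K] by auto
    with d show False by blast
  qed
  then have HK_le: "H \<inter> K \<subseteq> frattini G"
    using HG by (auto simp: frattini_def)
  have "proper_subgroup (L <#> K) G" if L: "maximal_subgroup L (G\<lparr>carrier := H\<rparr>)" for L
  proof -
    note LH = maximal_subgroupD[OF L]
    have LG: "subgroup L G" by (rule incl_subgroup[OF H LH(1)])
    have "subgroup (L <#> K) G"
      using mult_norm_subgroup[OF K LG] commut_normal[OF LG K] by simp
    moreover have "L <#> K \<noteq> carrier G"
    proof
      assume LK: "L <#> K = carrier G"
      have "H \<subseteq> L"
      proof
        fix h assume h: "h \<in> H"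
        then have "h \<in> L <#> K" using LK HG by auto
        then obtain l k where lk: "l \<in> L" "k \<in> K" "h = l \<otimes> k"
          by (auto simp: set_mult_def)
        have lH: "l \<in> H" using LH(1) lk(1) subgroup.subset by force
        have "l \<in> carrier G" "k \<in> carrier G" using lk lH HG KG by auto
        then have "k = inv l \<otimes> h" using lk(3) by (simp add: inv_solve_left)
        then have "k \<in> H" using h lH H by (simp add: subgroup.m_closed subgroup.m_inv_closed)
        then have "k \<in> L" using HK_le le[OF L] lk(2) by blast
        with lk LG show "h \<in> L" by (simp add: subgroup.m_closed)
      qed
      then show False using LH(1,2) subgroup.subset by force
    qed
    ultimately show ?thesis by (simp add: proper_subgroup_def)
  qed
  then show ?thesis
    unfolding M_supplemented_def using HK normal_imp_subgroup[OF K] by blast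
qed

text \<open>Modulo the Frattini subgroup such an \<open>H\<close> is no larger than \<open>L\<close>, so any maximal subgroup of \<open>G\<close>
  that contains \<open>L K\<close> also contains \<open>H K\<close>.\<close>

lemma not_M_supplemented_if_le_frattini_mult:
  assumes H: "subgroup H G" and L: "maximal_subgroup L (G\<lparr>carrier := H\<rparr>)"
    and le: "H \<subseteq> frattini G <#> L"
  shows "\<not> M_supplemented H G"
proof
  assume "M_supplemented H G"
  then obtain K where K: "subgroup K G" "carrier G = H <#> K" "proper_subgroup (L <#> K) G"
    using L by (auto simp: M_supplemented_def)
  obtain M where M: "maximal_subgroup M G" and LKM: "L <#> K \<subseteq> M"
    using proper_subgroup_le_maximal[OF finite_carrier K(3)] .
  note MD = maximal_subgroupD[OF M]
  have LG: "subgroup L G" by (rule incl_subgroup[OF H maximal_subgroupD(1)[OF L]])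
  have "L \<subseteq> L <#> K" "K \<subseteq> L <#> K"
    by (rule subset_set_mult[OF LG K(1)])+
  then have "L \<subseteq> M" "K \<subseteq> M" using LKM by auto
  moreover have "frattini G \<subseteq> M" using M by (auto simp: frattini_def)
  ultimately have "frattini G <#> L \<subseteq> M <#> M"
    by (intro mono_set_mult)
  with le have "H \<subseteq> M" by (simp add: subgroup_mult_id[OF MD(1)])
  then have "H <#> K \<subseteq> M <#> M" using \<open>K \<subseteq> M\<close> by (intro mono_set_mult)
  then have "carrier G \<subseteq> M" using K(2) by (simp add: subgroup_mult_id[OF MD(1)])
  with MD(2) subgroup.subset[OF MD(1)] show False by blast
qed

end

lemma finite_p_group_imp_locale:
  assumes "prime p" "finite_p_group p G"
  shows "finite_prime_power_group G p"
  using assms by (simp add: finite_p_group_def finite_prime_power_group_def finite_prime_power_group_axioms_def)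

theorem corollaryC:
  fixes G :: "('a, 'b) monoid_scheme" and p k :: nat
  assumes "prime p" and "finite_p_group p G" and "k \<ge> 1" and "p ^ k \<le> order G"
  shows "in_class_M G (p ^ k) \<longleftrightarrow>
    (\<forall>H. subgroup H G \<and> card H = p ^ (k - 1) \<longrightarrow> frattini G \<subseteq> H)"
proof -
  interpret finite_prime_power_group G p
    by (rule finite_p_group_imp_locale[OF assms(1,2)])
  have pk: "p ^ k = p * p ^ (k - 1)" using assms(3) by (cases k) auto
  have p0: "p > 0" using prime_gt_0_nat[OF assms(1)] .
  show ?thesis
  proof (intro iffI allI impI; (elim conjE)?)
    fix L assume cM: "in_class_M G (p ^ k)" and L: "subgroup L G" "card L = p ^ (k - 1)"
    show "frattini G \<subseteq> L"
    proof (rule ccontr)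
      assume nle: "\<not> frattini G \<subseteq> L"
      let ?J = "frattini G <#>\<^bsub>G\<^esub> L"
      have J: "subgroup ?J G" by (rule mult_norm_subgroup[OF normal_frattini L(1)])
      have "L \<subseteq> ?J" "frattini G \<subseteq> ?J"
        by (rule subset_set_mult[OF normal_imp_subgroup[OF normal_frattini] L(1)])+
      with nle have "L \<subset> ?J" by blast
      then obtain H where H: "subgroup H G" "H \<subseteq> ?J" "maximal_subgroup L (G\<lparr>carrier := H\<rparr>)"
        using subgroup_above_with_maximal[OF finite_carrier L(1) J] by blast
      have "card H = p ^ k"
        using maximal_subgroup_of_subgroup_card[OF H(1,3)] L(2) pk by simp
      with cM H(1) have "M_supplemented H G" by (simp add: in_class_M_def)
      with not_M_supplemented_if_le_frattini_mult[OF H(1,3,2)] show False by blast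
    qed
  next
    assume le: "\<forall>L. subgroup L G \<and> card L = p ^ (k - 1) \<longrightarrow> frattini G \<subseteq> L"
    show "in_class_M G (p ^ k)"
      unfolding in_class_M_def
    proof (intro allI impI; elim conjE)
      fix H assume H: "subgroup H G" "card H = p ^ k"
      show "M_supplemented H G"
      proof (rule M_supplemented_if_frattini_le_maximal[OF H(1)])
        fix L assume L: "maximal_subgroup L (G\<lparr>carrier := H\<rparr>)"
        have "card L = p ^ (k - 1)"
          using maximal_subgroup_of_subgroup_card[OF H(1) L] H(2) pk p0 by simp
        moreover have "subgroup L G"
          by (rule incl_subgroup[OF H(1) maximal_subgroupD(1)[OF L]])
        ultimately show "frattini G \<subseteq> L" using le by blast
      qed
    qed
  qed
qed

end
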